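(* Let $a,b$ be positive integers, $P=[a]\times[b]$, $\mathbb{S}$ a skew field of characteristic zero, $C$ a generic element of the center of $\mathbb{S}$, and $g\in\mathbb{S}^P$ a (generic) labeling. Then (1) $(\operatorname{NAR} g)(1,1)=C\cdot\overline{(\Delta^{-1}g)(1,1)}$; (2) $(\operatorname{NAR} g)(1,j)=\overline{(\Delta^{-1}g)(1,j)}\cdot(\Delta^{-1}g)(1,j-1)$ for $j\ge 2$; (3) $(\operatorname{NAR} g)(i,1)=\overline{(\Delta^{-1}g)(i,1)}\cdot(\Delta^{-1}g)(i-1,1)$ for $i\ge 2$; (4) for $i,j\ge 2$, $(\operatorname{NAR} g)(i,j)=\overline{(\Delta^{-1}g)(i,j)}\cdot(\Delta^{-1}g)(i-1,j)\cdot g(i-1,j-1)\cdot\overline{(\Delta^{-1}g)(i-1,j-1)}\cdot(\Delta^{-1}g)(i,j-1)$ $=\overline{(\Delta^{-1}g)(i,j)}\cdot(\Delta^{-1}g)(i,j-1)\cdot g(i-1,j-1)\cdot\overline{(\Delta^{-1}g)(i-1,j-1)}\cdot(\Delta^{-1}g)(i-1,j)$.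
   Context: $[n]=\{1,\dots,n\}$; $P=[a]\times[b]$ has componentwise order, and $(i,j)$ is covered exactly by $(i+1,j)$ and $(i,j+1)$ when these lie in $P$. Write $\overline{x}=x^{-1}$ for $x\in\mathbb{S}$. All maps are rational maps on $\mathbb{S}^P$ (labelings $P\to\mathbb{S}$), defined for generic labelings. Define: $(\Theta f)(x)=C\cdot\overline{f(x)}$; $(\nabla f)(x)=f(x)\cdot\overline{\sum_{y\lessdot x}f(y)}$, where the empty sum (for $x$ minimal) is replaced by $1$; $(\Delta^{-1}f)(x)=\sum f(y_k)\cdots f(y_2)f(y_1)$ over all saturated chains $x=y_1\lessdot y_2\lessdot\cdots\lessdot y_k$ with $y_k$ maximal in $P$, equivalently $(\Delta^{-1}f)(x)=\big(\sum_{y\gtrdot x}(\Delta^{-1}f)(y)\big)\cdot f(x)$ with the empty sum equal to $1$. Noncommutative antichain rowmotion is $\operatorname{NAR}=\nabla\circ\Theta\circ\Delta^{-1}$. *)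

theory Defs
  imports Complex_Main "HOL-Library.Product_Order"
begin

text \<open>The componentwise order on pairs is the one provided by \<^theory>\<open>HOL-Library.Product_Order\<close>.\<close>

definition rect :: "nat \<Rightarrow> nat \<Rightarrow> (nat \<times> nat) set" where
  "rect a b = {1..a} \<times> {1..b}"

definition covered_by :: "'p::order set \<Rightarrow> 'p \<Rightarrow> 'p \<Rightarrow> bool" where
  "covered_by P x y \<longleftrightarrow> x \<in> P \<and> y \<in> P \<and> x < y \<and> \<not> (\<exists>z\<in>P. x < z \<and> z < y)"

lemma covered_by_rect:
  "covered_by (rect a b) (i, j) y \<longleftrightarrow>
     (i, j) \<in> rect a b \<and> y \<in> rect a b \<and> (y = (i + 1, j) \<or> y = (i, j + 1))"
proof (cases y)
  case (Pair k l)
  have lt: "(p, q) < (r, s) \<longleftrightarrow> p \<le> r \<and> q \<le> s \<and> (p < r \<or> q < s)" for p q r s :: nat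
    by (auto simp: less_le)
  show ?thesis
  proof
    assume L: "covered_by (rect a b) (i, j) y"
    then have P: "(i, j) \<in> rect a b" "(k, l) \<in> rect a b" and "(i, j) < (k, l)"
      and no: "\<And>z. z \<in> rect a b \<Longrightarrow> (i, j) < z \<Longrightarrow> \<not> z < (k, l)"
      by (auto simp: covered_by_def Pair)
    then have le: "i \<le> k" "j \<le> l" "i < k \<or> j < l" by (auto simp: lt)
    have "(k, l) = (i + 1, j)" if "i < k"
      using no[of "(i + 1, j)"] that le P by (auto simp: lt rect_def)
    moreover have "(k, l) = (i, j + 1)" if "j < l"
      using no[of "(i, j + 1)"] that le P by (auto simp: lt rect_def)
    ultimately show "(i, j) \<in> rect a b \<and> y \<in> rect a b \<and> (y = (i + 1, j) \<or> y = (i, j + 1))"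
      using P le(3) Pair by auto
  next
    assume "(i, j) \<in> rect a b \<and> y \<in> rect a b \<and> (y = (i + 1, j) \<or> y = (i, j + 1))"
    then show "covered_by (rect a b) (i, j) y"
      by (auto simp: covered_by_def lt)
  qed
qed

definition maximal_elt :: "'p::order set \<Rightarrow> 'p \<Rightarrow> bool" where
  "maximal_elt P x \<longleftrightarrow> x \<in> P \<and> \<not> (\<exists>y\<in>P. x < y)"

definition minimal_elt :: "'p::order set \<Rightarrow> 'p \<Rightarrow> bool" where
  "minimal_elt P x \<longleftrightarrow> x \<in> P \<and> \<not> (\<exists>y\<in>P. y < x)"

definition sat_chains_to_max :: "'p::order set \<Rightarrow> 'p \<Rightarrow> 'p list set" where
  "sat_chains_to_max P x =
     {ys. ys \<noteq> [] \<and> hd ys = x \<and> set ys \<subseteq> P \<and>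
          successively (covered_by P) ys \<and> maximal_elt P (last ys)}"

lemma finite_sat_chains_to_max:
  assumes "finite P"
  shows "finite (sat_chains_to_max P x)"
proof (rule finite_subset)
  have "distinct ys" if "successively (covered_by P) ys" for ys
  proof -
    have "successively (<) ys"
      using that by (rule successively_mono) (simp add: covered_by_def)
    then have "sorted_wrt (<) ys"
      by (subst (asm) successively_conv_sorted_wrt) (auto simp: transp_def)
    then show ?thesis by (induction ys) auto
  qed
  then show "sat_chains_to_max P x \<subseteq> {ys. set ys \<subseteq> P \<and> distinct ys}"
    by (auto simp: sat_chains_to_max_def)
  show "finite {ys. set ys \<subseteq> P \<and> distinct ys}"
    using assms by (rule finite_subset_distinct)
qed

text \<open>
  A labeling is a function on the ambient type of which only the values on \<open>P\<close> matter.
  The maps below are rational maps; in HOL they are made total by \<open>inverse 0 = 0\<close>, and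
  \<open>NAR_defined\<close> describes the labelings at which no inverse of zero is taken.
\<close>

definition Theta :: "'s::division_ring \<Rightarrow> ('p \<Rightarrow> 's) \<Rightarrow> 'p \<Rightarrow> 's" where
  "Theta C f x = C * inverse (f x)"

definition Nabla :: "'p::order set \<Rightarrow> ('p \<Rightarrow> 's::division_ring) \<Rightarrow> 'p \<Rightarrow> 's" where
  "Nabla P f x =
     f x * inverse (if minimal_elt P x then 1 else (\<Sum>y | covered_by P y x. f y))"

definition Delta_inv :: "'p::order set \<Rightarrow> ('p \<Rightarrow> 's::division_ring) \<Rightarrow> 'p \<Rightarrow> 's" where
  "Delta_inv P f x = (\<Sum>ys \<in> sat_chains_to_max P x. prod_list (map f (rev ys)))"

lemma Delta_inv_rec:
  assumes "finite P" "x \<in> P"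
  shows "Delta_inv P f x =
    (if maximal_elt P x then 1 else (\<Sum>y | covered_by P x y. Delta_inv P f y)) * f x"
proof (cases "maximal_elt P x")
  case True
  then have "\<not> covered_by P x y" for y
    by (auto simp: maximal_elt_def covered_by_def)
  then have "sat_chains_to_max P x = {[x]}"
    using True assms
    by (auto simp: sat_chains_to_max_def successively_Cons neq_Nil_conv)
  then show ?thesis using True by (simp add: Delta_inv_def)
next
  case False
  let ?U = "{y. covered_by P x y}"
  have finU: "finite ?U"
    by (rule finite_subset[OF _ assms(1)]) (auto simp: covered_by_def)
  have eq: "sat_chains_to_max P x = (#) x ` (\<Union>y\<in>?U. sat_chains_to_max P y)"
  proof (intro equalityI subsetI)
    fix ys assume ys: "ys \<in> sat_chains_to_max P x"
    then obtain zs where zs: "ys = x # zs"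
      by (cases ys) (auto simp: sat_chains_to_max_def)
    with ys False have "zs \<noteq> []" by (auto simp: sat_chains_to_max_def)
    with ys zs have "zs \<in> sat_chains_to_max P (hd zs)" "covered_by P x (hd zs)"
      by (auto simp: sat_chains_to_max_def successively_Cons)
    then show "ys \<in> (#) x ` (\<Union>y\<in>?U. sat_chains_to_max P y)"
      using zs by blast
  next
    fix ys assume "ys \<in> (#) x ` (\<Union>y\<in>?U. sat_chains_to_max P y)"
    then show "ys \<in> sat_chains_to_max P x"
      using assms(2) by (auto simp: sat_chains_to_max_def successively_Cons)
  qed
  have "Delta_inv P f x =
      (\<Sum>ys\<in>(\<Union>y\<in>?U. sat_chains_to_max P y). prod_list (map f (rev ys)) * f x)"
    unfolding Delta_inv_def eq by (subst sum.reindex) auto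
  also have "\<dots> = (\<Sum>y\<in>?U. \<Sum>ys\<in>sat_chains_to_max P y. prod_list (map f (rev ys)) * f x)"
    by (rule sum.UNION_disjoint)
       (use finU assms(1) in \<open>auto simp: finite_sat_chains_to_max\<close>,
        auto simp: sat_chains_to_max_def)
  also have "\<dots> = (\<Sum>y\<in>?U. Delta_inv P f y) * f x"
    by (simp add: Delta_inv_def sum_distrib_right)
  finally show ?thesis using False by simp
qed

definition NAR :: "'p::order set \<Rightarrow> 's::division_ring \<Rightarrow> ('p \<Rightarrow> 's) \<Rightarrow> 'p \<Rightarrow> 's" where
  "NAR P C = Nabla P \<circ> Theta C \<circ> Delta_inv P"

definition Theta_defined :: "'p set \<Rightarrow> ('p \<Rightarrow> 's::division_ring) \<Rightarrow> bool" where
  "Theta_defined P f \<longleftrightarrow> (\<forall>x\<in>P. f x \<noteq> 0)"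

definition Nabla_defined :: "'p::order set \<Rightarrow> ('p \<Rightarrow> 's::division_ring) \<Rightarrow> bool" where
  "Nabla_defined P f \<longleftrightarrow>
     (\<forall>x\<in>P. \<not> minimal_elt P x \<longrightarrow> (\<Sum>y | covered_by P y x. f y) \<noteq> 0)"

definition NAR_defined :: "'p::order set \<Rightarrow> 's::division_ring \<Rightarrow> ('p \<Rightarrow> 's) \<Rightarrow> bool" where
  "NAR_defined P C g \<longleftrightarrow>
     Theta_defined P (Delta_inv P g) \<and> Nabla_defined P (Theta C (Delta_inv P g))"

end

theory Submission
  imports Defs
begin

text \<open>
  Since \<open>C\<close> is central, it cancels in \<open>Nabla \<circ> Theta\<close> at every non-minimal element. In the interior
  the remaining inverse of \<open>inverse u + inverse v\<close> is the parallel sum \<open>u * inverse (u + v) * v\<close>, which is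
  symmetric in \<open>u\<close> and \<open>v\<close>, and \<open>u + v\<close> is the sum occurring in the recursion for \<open>Delta_inv\<close> at
  \<open>(i - 1, j - 1)\<close>.
\<close>

text \<open>Factor \<open>inverse u + inverse v\<close> as
  \<open>inverse v * (u + v) * inverse u\<close>; inverting reverses the factors. If
  \<open>u + v = 0\<close>, then \<open>v = - u\<close> and both sides are 0 by the convention
  \<open>inverse 0 = 0\<close>.\<close>

lemma inverse_add_inverse:
  fixes u v :: "'s::division_ring"
  assumes "u \<noteq> 0" "v \<noteq> 0"
  shows "inverse (inverse u + inverse v) = u * inverse (u + v) * v"
proof (cases "u + v = 0")
  case True
  then have "v = - u" by (simp add: eq_neg_iff_add_eq_0 add.commute)
  then show ?thesis using assms by (simp add: nonzero_inverse_minus_eq)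
next
  case False
  have "inverse u + inverse v = inverse v * (u + v) * inverse u"
    using assms by (simp add: distrib_left distrib_right mult.assoc)
  then show ?thesis
    using assms False by (simp add: nonzero_inverse_mult_distrib mult.assoc)
qed

text \<open>Meant for \<open>s = u + v\<close> and \<open>h\<close> the label at
  \<open>(i - 1, j - 1)\<close>, where \<open>s * h\<close> is the value of \<open>Delta_inv\<close>
  there.\<close>

lemma mult_inverse_mult_cancel_left:
  fixes s h :: "'s::division_ring"
  assumes "s * h \<noteq> 0"
  shows "h * inverse (s * h) = inverse s"
proof -
  have "s \<noteq> 0" "h \<noteq> 0" using assms by auto
  then show ?thesis
    by (simp add: nonzero_inverse_mult_distrib mult.assoc[symmetric])
qed

lemma NAR_minimal:
  "minimal_elt P x \<Longrightarrow> NAR P C g x = C * inverse (Delta_inv P g x)"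
  by (simp add: NAR_def Nabla_def Theta_def)

lemma NAR_non_minimal:
  fixes C :: "'s::division_ring"
  assumes "\<not> minimal_elt P x" and C: "\<forall>s. C * s = s * C" "C \<noteq> 0"
  shows "NAR P C g x =
    inverse (Delta_inv P g x) * inverse (\<Sum>y | covered_by P y x. inverse (Delta_inv P g y))"
    (is "_ = ?w * inverse ?s")
proof -
  have "NAR P C g x = C * ?w * inverse (C * ?s)"
    using assms(1) by (simp add: NAR_def Nabla_def Theta_def sum_distrib_left)
  also have "\<dots> = ?w * inverse ?s"
  \<comment> \<open>For \<open>?s = 0\<close> both sides are 0, since
    \<open>inverse 0 = 0\<close>.\<close>
  proof (cases "?s = 0")
    case False
    \<comment> \<open>Inverting \<open>C * ?s\<close> puts \<open>inverse C\<close> on the far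
      right, so centrality has to carry \<open>C\<close> first past \<open>?w\<close> and then past
      \<open>inverse ?s\<close>.\<close>
    have "C * ?w * inverse (C * ?s) = ?w * (C * inverse ?s) * inverse C"
      unfolding C(1)[rule_format, of ?w]
      using C(2) False by (simp add: nonzero_inverse_mult_distrib mult.assoc)
    also have "\<dots> = ?w * (inverse ?s * C) * inverse C" using C by metis
    also have "\<dots> = ?w * inverse ?s" using C(2) by (simp add: mult.assoc)
    finally show ?thesis .
  qed simp
  finally show ?thesis .
qed

text \<open>Stated with successors of the coordinates of \<open>y\<close>, which avoids truncated
  subtraction at the border.\<close>

lemma lower_covers_rect:
  "{y. covered_by (rect a b) y (i, j)} =
    {y \<in> rect a b. (i, j) \<in> rect a b \<and> ((i, j) = (fst y + 1, snd y) \<or> (i, j) = (fst y, snd y + 1))}"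
  by (auto simp: covered_by_rect)

lemma upper_covers_rect:
  "{y. covered_by (rect a b) (i, j) y} =
    {y \<in> rect a b. (i, j) \<in> rect a b \<and> (y = (i + 1, j) \<or> y = (i, j + 1))}"
  by (auto simp: covered_by_rect)

lemma minimal_elt_rect_iff:
  assumes "(i, j) \<in> rect a b"
  shows "minimal_elt (rect a b) (i, j) \<longleftrightarrow> (i, j) = (1, 1)"
proof
  assume L: "minimal_elt (rect a b) (i, j)"
  have "(1, 1) \<in> rect a b" "(1, 1) \<le> (i, j)" using assms by (auto simp: rect_def)
  with L show "(i, j) = (1, 1)" by (metis minimal_elt_def order_le_less)
next
  assume "(i, j) = (1, 1)"
  with assms show "minimal_elt (rect a b) (i, j)"
    by (auto simp: minimal_elt_def rect_def less_le)
qed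

theorem theorem4p7:
  fixes a b :: nat
    and C :: "'s::{division_ring, ring_char_0}"
    and g :: "nat \<times> nat \<Rightarrow> 's"
  assumes "a \<ge> 1" and "b \<ge> 1"
    and C_central: "\<forall>s. C * s = s * C"
    and C_generic: "C \<noteq> 0"
    and g_generic: "NAR_defined (rect a b) C g"
  shows
    "NAR (rect a b) C g (1, 1) = C * inverse (Delta_inv (rect a b) g (1, 1))
     \<and> (\<forall>j\<in>{2..b}. NAR (rect a b) C g (1, j) =
           inverse (Delta_inv (rect a b) g (1, j)) * Delta_inv (rect a b) g (1, j - 1))
     \<and> (\<forall>i\<in>{2..a}. NAR (rect a b) C g (i, 1) =
           inverse (Delta_inv (rect a b) g (i, 1)) * Delta_inv (rect a b) g (i - 1, 1))
     \<and> (\<forall>i\<in>{2..a}. \<forall>j\<in>{2..b}.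
           NAR (rect a b) C g (i, j) =
             inverse (Delta_inv (rect a b) g (i, j)) * Delta_inv (rect a b) g (i - 1, j)
             * g (i - 1, j - 1) * inverse (Delta_inv (rect a b) g (i - 1, j - 1))
             * Delta_inv (rect a b) g (i, j - 1)
         \<and> NAR (rect a b) C g (i, j) =
             inverse (Delta_inv (rect a b) g (i, j)) * Delta_inv (rect a b) g (i, j - 1)
             * g (i - 1, j - 1) * inverse (Delta_inv (rect a b) g (i - 1, j - 1))
             * Delta_inv (rect a b) g (i - 1, j))"
proof (intro conjI ballI)
  let ?P = "rect a b"
  let ?D = "Delta_inv ?P g"
  note NARs = NAR_non_minimal[OF _ C_central C_generic]
  have D_nz: "?D x \<noteq> 0" if "x \<in> ?P" for x
    using g_generic that by (auto simp: NAR_defined_def Theta_defined_def)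
  have "(1, 1) \<in> ?P" using assms(1,2) by (simp add: rect_def)
  then show "NAR ?P C g (1, 1) = C * inverse (?D (1, 1))"
    by (intro NAR_minimal) (simp add: minimal_elt_rect_iff)
  show "NAR ?P C g (1, j) = inverse (?D (1, j)) * ?D (1, j - 1)" if "j \<in> {2..b}" for j
  proof -
    have P: "(1, j) \<in> ?P" using that assms(1) by (simp add: rect_def)
    \<comment> \<open>With a single lower cover the two inversions cancel and leave
      \<open>?D (1, j - 1)\<close>.\<close>
    have "{y. covered_by ?P y (1, j)} = {(1, j - 1)}"
      unfolding lower_covers_rect using P that by (auto simp: rect_def)
    with P that D_nz show ?thesis by (subst NARs) (auto simp: minimal_elt_rect_iff)
  qed
  show "NAR ?P C g (i, 1) = inverse (?D (i, 1)) * ?D (i - 1, 1)" if "i \<in> {2..a}" for i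
  proof -
    have P: "(i, 1) \<in> ?P" using that assms(2) by (simp add: rect_def)
    have "{y. covered_by ?P y (i, 1)} = {(i - 1, 1)}"
      unfolding lower_covers_rect using P that by (auto simp: rect_def)
    with P that D_nz show ?thesis by (subst NARs) (auto simp: minimal_elt_rect_iff)
  qed
  fix i j assume i: "i \<in> {2..a}" and j: "j \<in> {2..b}"
  define u v h where "u = ?D (i - 1, j)" and "v = ?D (i, j - 1)" and "h = g (i - 1, j - 1)"
  have P: "(i, j) \<in> ?P" "(i - 1, j) \<in> ?P" "(i, j - 1) \<in> ?P" "(i - 1, j - 1) \<in> ?P"
    using i j by (auto simp: rect_def)
  have nz: "u \<noteq> 0" "v \<noteq> 0" using P D_nz by (auto simp: u_def v_def)
  \<comment> \<open>The two points are distinct because \<open>i - 1\<close> differs from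
    \<open>i\<close> for \<open>i \<ge> 2\<close>.\<close>
  have sum2: "(\<Sum>y\<in>{(i - 1, j), (i, j - 1)}. f y) = f (i - 1, j) + f (i, j - 1)"
    for f :: "nat \<times> nat \<Rightarrow> 's"
    using i by (subst sum.insert) auto
  have lower: "{y. covered_by ?P y (i, j)} = {(i - 1, j), (i, j - 1)}"
    unfolding lower_covers_rect using P by (auto simp: rect_def)
  have "\<not> minimal_elt ?P (i, j)" using P(1) i by (simp add: minimal_elt_rect_iff)
  then have NAR_uv: "NAR ?P C g (i, j) = inverse (?D (i, j)) * inverse (inverse u + inverse v)"
    unfolding u_def v_def by (simp only: NARs lower sum2 not_False_eq_True)
  \<comment> \<open>The same two points complete the diamond from below; this is what ties
    \<open>u + v\<close> to \<open>?D (i - 1, j - 1)\<close>.\<close>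
  have upper: "{y. covered_by ?P (i - 1, j - 1) y} = {(i - 1, j), (i, j - 1)}"
    unfolding upper_covers_rect using P by (auto simp: rect_def)
  \<comment> \<open>This selects the sum in the recursion instead of the default value 1.\<close>
  have "\<not> maximal_elt ?P (i - 1, j - 1)"
  proof -
    have "(i - 1, j - 1) < (i, j)" using i by (auto simp: less_le)
    then show ?thesis using P(1) by (auto simp: maximal_elt_def)
  qed
  moreover have "finite ?P" by (simp add: rect_def)
  ultimately have "?D (i - 1, j - 1) = (u + v) * h"
    unfolding u_def v_def h_def
    by (simp only: Delta_inv_rec[OF _ P(4)] upper sum2 if_False)
  then have h: "h * inverse (?D (i - 1, j - 1)) = inverse (u + v)"
    using D_nz[OF P(4)] mult_inverse_mult_cancel_left by metis
  show "NAR ?P C g (i, j) =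
      inverse (?D (i, j)) * ?D (i - 1, j) * g (i - 1, j - 1)
      * inverse (?D (i - 1, j - 1)) * ?D (i, j - 1)"
    unfolding NAR_uv inverse_add_inverse[OF nz] h[symmetric]
    by (simp add: u_def v_def h_def mult.assoc)
  \<comment> \<open>Both sums are commutative, so the parallel sum may be expanded with
    \<open>u\<close> and \<open>v\<close> exchanged.\<close>
  have "inverse (inverse u + inverse v) = v * (h * inverse (?D (i - 1, j - 1))) * u"
    using inverse_add_inverse[OF nz(2,1)] by (simp only: h add.commute)
  then show "NAR ?P C g (i, j) =
      inverse (?D (i, j)) * ?D (i, j - 1) * g (i - 1, j - 1)
      * inverse (?D (i - 1, j - 1)) * ?D (i - 1, j)"
    unfolding NAR_uv by (simp add: u_def v_def h_def mult.assoc)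
qed

end
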